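(* For any real numbers $x_1,x_2,\dots,x_n$ with $x_1+x_2+\cdots+x_n=0$, we have $$\frac{1}{n!}\sum_{\sigma}\max_{1\le k\le n}\left|\sum_{i=1}^k x_{\sigma(i)}\right|^2\le\left(8+\frac15\right)\sum_{i=1}^n x_i^2,$$ where the sum is taken over all permutations $\sigma$ of $\{1,\dots,n\}$.
   Context: The $x_i$ need not be distinct; $n\ge 1$. *)

theory Defs
  imports "HOL-Analysis.Analysis" "HOL-Combinatorics.Permutations"
begin

end

theory Submission
  imports Defs
begin

text \<open>
  Let \<open>S\<^sub>k\<close> be the \<open>k\<close>-th partial sum of the randomly permuted sequence. As the total is zero,
  \<open>S\<^sub>k / (n - k)\<close> is a martingale for \<open>k < n\<close>, and \<open>E S\<^sub>k\<^sup>2 = k (n - k) / (n (n - 1)) \<Sum> x\<^sub>i\<^sup>2\<close>.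
  Doob's maximal inequality in \<open>L\<^sup>2\<close> controls \<open>|S\<^sub>k|\<close> for \<open>k \<le> n div 2\<close>; the remaining indices are
  treated in the same way after reversing the permutation. Adding the two bounds gives
  the constant 8. Doob's inequality is obtained from a pathwise inequality, so that only
  the orthogonality of martingale increments to the past is needed.
\<close>

section \<open>Partial sums along a permutation\<close>

definition partial_sum :: "(nat \<Rightarrow> real) \<Rightarrow> (nat \<Rightarrow> nat) \<Rightarrow> nat \<Rightarrow> real" where
  "partial_sum x \<sigma> k = (\<Sum>i=1..k. x (\<sigma> i))"

lemma partial_sum_0 [simp]: "partial_sum x \<sigma> 0 = 0"
  by (simp add: partial_sum_def)

lemma partial_sum_Suc: "partial_sum x \<sigma> (Suc k) = partial_sum x \<sigma> k + x (\<sigma> (Suc k))"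
  by (simp add: partial_sum_def)

lemma partial_sum_cong: "(\<And>i. i \<in> {1..k} \<Longrightarrow> \<sigma> i = \<tau> i) \<Longrightarrow> partial_sum x \<sigma> k = partial_sum x \<tau> k"
  unfolding partial_sum_def by (intro sum.cong) auto

lemma partial_sum_transpose:
  assumes "l < i" "l < j"
  shows "partial_sum x (\<sigma> \<circ> Transposition.transpose i j) l = partial_sum x \<sigma> l"
  using assms by (intro partial_sum_cong) (auto simp: Transposition.transpose_def)

lemma partial_sum_complement:
  assumes "\<sigma> permutes {1..n}" "k \<le> n" "(\<Sum>i=1..n. x i) = 0"
  shows "(\<Sum>i=Suc k..n. x (\<sigma> i)) = - partial_sum x \<sigma> k"
proof -
  have "(\<Sum>i=1..n. x (\<sigma> i)) = 0"
    using sum.permute[OF assms(1), of x] assms(3) by (simp add: o_def)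
  moreover have "(\<Sum>i=1..n. x (\<sigma> i)) = (\<Sum>i=1..k. x (\<sigma> i)) + (\<Sum>i=Suc k..n. x (\<sigma> i))"
    using sum.ub_add_nat[of 1 k "\<lambda>i. x (\<sigma> i)" "n - k"] assms(2) by simp
  ultimately show ?thesis
    by (simp add: partial_sum_def)
qed

section \<open>Exchangeability, the martingale property and second moments\<close>

text \<open>Composition on the right with a transposition permutes the summation set; it
  interchanges the values at \<open>i\<close> and \<open>j\<close> and leaves \<open>g\<close>
  unchanged.\<close>

lemma sum_permutes_exchange:
  fixes h :: "nat \<Rightarrow> real"
  assumes "i \<in> S" "j \<in> S"
    and "\<And>\<sigma>. g (\<sigma> \<circ> Transposition.transpose i j) = g \<sigma>"
  shows "(\<Sum>\<sigma> | \<sigma> permutes S. g \<sigma> * h (\<sigma> i)) = (\<Sum>\<sigma> | \<sigma> permutes S. g \<sigma> * h (\<sigma> j))"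
  using sum_permutations_compose_right[OF permutes_swap_id[OF assms(1,2)],
      of "\<lambda>\<sigma>. g \<sigma> * h (\<sigma> i)"] assms(3)
  by simp

text \<open>The invariance of \<open>g\<close> expresses dependence on the first \<open>k\<close>
  values only. By exchangeability, position \<open>Suc k\<close> may be replaced by each of the
  \<open>n - k\<close> later positions; the terms there add up to minus the partial sum, as the
  total is zero.\<close>

lemma sum_permutes_next:
  assumes "k < n" "(\<Sum>i=1..n. x i) = 0"
    and "\<And>\<sigma> j. k < j \<Longrightarrow> g (\<sigma> \<circ> Transposition.transpose (Suc k) j) = g \<sigma>"
  shows "real (n - k) * (\<Sum>\<sigma> | \<sigma> permutes {1..n}. g \<sigma> * x (\<sigma> (Suc k)))
    = - (\<Sum>\<sigma> | \<sigma> permutes {1..n}. g \<sigma> * partial_sum x \<sigma> k)"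
proof -
  have "real (n - k) * (\<Sum>\<sigma> | \<sigma> permutes {1..n}. g \<sigma> * x (\<sigma> (Suc k)))
      = (\<Sum>j=Suc k..n. \<Sum>\<sigma> | \<sigma> permutes {1..n}. g \<sigma> * x (\<sigma> (Suc k)))"
    by simp
  also have "\<dots> = (\<Sum>j=Suc k..n. \<Sum>\<sigma> | \<sigma> permutes {1..n}. g \<sigma> * x (\<sigma> j))"
    using assms by (intro sum.cong refl sum_permutes_exchange) auto
  also have "\<dots> = (\<Sum>\<sigma> | \<sigma> permutes {1..n}. g \<sigma> * (\<Sum>j=Suc k..n. x (\<sigma> j)))"
    by (subst sum.swap) (simp add: sum_distrib_left)
  also have "\<dots> = (\<Sum>\<sigma> | \<sigma> permutes {1..n}. - (g \<sigma> * partial_sum x \<sigma> k))"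
    using assms by (intro sum.cong refl) (simp add: partial_sum_complement)
  finally show ?thesis
    by (simp add: sum_negf)
qed

text \<open>Given the past, the next term has mean
  \<open>- partial_sum x \<sigma> k / (n - k)\<close>, which the change of denominator cancels
  exactly. The bound \<open>Suc k < n\<close> keeps both denominators positive.\<close>

lemma martingale_increment:
  assumes "Suc k < n" "(\<Sum>i=1..n. x i) = 0"
    and "\<And>\<sigma> j. k < j \<Longrightarrow> g (\<sigma> \<circ> Transposition.transpose (Suc k) j) = g \<sigma>"
  shows "(\<Sum>\<sigma> | \<sigma> permutes {1..n}.
      g \<sigma> * (partial_sum x \<sigma> (Suc k) / real (n - Suc k) - partial_sum x \<sigma> k / real (n - k))) = 0"
proof -
  have pos: "real (n - k) = real (n - Suc k) + 1" "real (n - Suc k) > 0"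
    using assms(1) by auto
  have "g \<sigma> * (partial_sum x \<sigma> (Suc k) / real (n - Suc k) - partial_sum x \<sigma> k / real (n - k))
      = (g \<sigma> * partial_sum x \<sigma> k + real (n - k) * (g \<sigma> * x (\<sigma> (Suc k))))
        / (real (n - k) * real (n - Suc k))" for \<sigma>
    unfolding pos(1) using pos(2) by (simp add: partial_sum_Suc field_simps)
  then show ?thesis
    using sum_permutes_next[OF _ assms(2,3)] assms(1)
    by (simp add: sum.distrib flip: sum_divide_distrib sum_distrib_left)
qed

text \<open>All positions contribute equally by exchangeability, and for each permutation the sum
  over all positions is the sum of \<open>h\<close>.\<close>

lemma sum_permutes_apply:
  fixes h :: "nat \<Rightarrow> real"
  assumes "k \<in> {1..n}"
  shows "real n * (\<Sum>\<sigma> | \<sigma> permutes {1..n}. h (\<sigma> k)) = fact n * (\<Sum>i=1..n. h i)"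
proof -
  have "real n * (\<Sum>\<sigma> | \<sigma> permutes {1..n}. h (\<sigma> k))
      = (\<Sum>j=1..n. \<Sum>\<sigma> | \<sigma> permutes {1..n}. h (\<sigma> k))"
    by simp
  also have "\<dots> = (\<Sum>j=1..n. \<Sum>\<sigma> | \<sigma> permutes {1..n}. h (\<sigma> j))"
    by (rule sum.cong[OF refl])
      (use sum_permutes_exchange[of k "{1..n}" _ "\<lambda>_. 1" h] assms in simp)
  also have "\<dots> = (\<Sum>\<sigma> | \<sigma> permutes {1..n}. \<Sum>j=1..n. h j)"
    by (subst sum.swap, rule sum.cong[OF refl]) (use sum.permute[of _ "{1..n}" h] in \<open>simp add: o_def\<close>)
  finally show ?thesis
    using card_permutations[of "{1..n}" n] by simp
qed

lemma sum_permutes_partial_sum_square: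
  assumes "2 \<le> n" "k \<le> n" "(\<Sum>i=1..n. x i) = 0"
  shows "(\<Sum>\<sigma> | \<sigma> permutes {1..n}. (partial_sum x \<sigma> k)\<^sup>2)
    = fact n * (real k * (real n - real k) / (real n * (real n - 1)) * (\<Sum>i=1..n. (x i)\<^sup>2))"
  using assms(2)
proof (induction k)
  case (Suc k)
  let ?Q = "\<Sum>i=1..n. (x i)\<^sup>2"
  let ?E = "\<lambda>f. \<Sum>\<sigma> | \<sigma> permutes {1..n}. f \<sigma>"
  \<comment> \<open>The partial sum itself serves as the past-dependent weight, so the cross term
    reduces to the second moment known by induction.\<close>
  have "real (n - k) * ?E (\<lambda>\<sigma>. partial_sum x \<sigma> k * x (\<sigma> (Suc k)))
      = - ?E (\<lambda>\<sigma>. (partial_sum x \<sigma> k)\<^sup>2)"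
    unfolding power2_eq_square
    by (rule sum_permutes_next) (use Suc.prems assms(3) in \<open>auto simp: partial_sum_transpose\<close>)
  then have "(real n - real k) * ?E (\<lambda>\<sigma>. partial_sum x \<sigma> k * x (\<sigma> (Suc k)))
      = - ?E (\<lambda>\<sigma>. (partial_sum x \<sigma> k)\<^sup>2)"
    using Suc.prems by (simp add: of_nat_diff)
  also have "\<dots> = (real n - real k) * (- fact n * (real k / (real n * (real n - 1)) * ?Q))"
    using Suc by (simp add: mult_ac)
  finally have cross: "?E (\<lambda>\<sigma>. partial_sum x \<sigma> k * x (\<sigma> (Suc k)))
      = - fact n * (real k / (real n * (real n - 1)) * ?Q)"
    using Suc.prems by (subst (asm) mult_left_cancel) auto
  have square: "?E (\<lambda>\<sigma>. (x (\<sigma> (Suc k)))\<^sup>2) = fact n * (1 / real n * ?Q)"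
    using sum_permutes_apply[of "Suc k" n "\<lambda>i. (x i)\<^sup>2"] Suc.prems by (simp add: field_simps)
  have "?E (\<lambda>\<sigma>. (partial_sum x \<sigma> (Suc k))\<^sup>2)
      = ?E (\<lambda>\<sigma>. (partial_sum x \<sigma> k)\<^sup>2) + 2 * ?E (\<lambda>\<sigma>. partial_sum x \<sigma> k * x (\<sigma> (Suc k)))
        + ?E (\<lambda>\<sigma>. (x (\<sigma> (Suc k)))\<^sup>2)"
    by (simp add: partial_sum_Suc power2_sum sum.distrib sum_distrib_left mult_ac)
  also have "\<dots> = fact n * ((real k * (real n - real k) / (real n * (real n - 1))
      - 2 * (real k / (real n * (real n - 1))) + 1 / real n) * ?Q)"
    unfolding cross square Suc.IH[OF Suc_leD[OF Suc.prems]] by (simp add: algebra_simps)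
  also have "real k * (real n - real k) / (real n * (real n - 1))
      - 2 * (real k / (real n * (real n - 1))) + 1 / real n
      = real (Suc k) * (real n - real (Suc k)) / (real n * (real n - 1))"
    using assms(1) by (simp add: divide_simps) (simp add: algebra_simps)
  finally show ?case .
qed simp

section \<open>Doob's maximal inequality\<close>

text \<open>The sum on the left is a discrete stochastic integral of the running maximum against
  \<open>a\<close>. For a submartingale its expectation is nonnegative, so averaging yields the
  \<open>L2\<close> inequality with constant 4.\<close>

lemma pathwise_doob:
  fixes a :: "nat \<Rightarrow> real"
  assumes "\<And>k. 0 \<le> a k"
  shows "(MAX k\<in>{..m}. a k)\<^sup>2 + 4 * (\<Sum>k<m. (MAX i\<in>{..k}. a i) * (a (Suc k) - a k)) \<le> 4 * (a m)\<^sup>2"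
proof -
  define A where "A k = (MAX i\<in>{..k}. a i)" for k
  have A_Suc: "A (Suc k) = max (a (Suc k)) (A k)" for k
    unfolding A_def atMost_Suc by (subst image_insert, subst Max_insert) auto
  have A_nonneg: "0 \<le> A k" for k
    using assms[of 0] by (induction k) (auto simp: A_Suc le_max_iff_disj, simp add: A_def)
  have transform: "(\<Sum>k<m. A k * (a (Suc k) - a k)) \<le> A m * a m - (A m)\<^sup>2 / 2" for m
  proof (induction m)
    case 0
    then show ?case by (simp add: A_def power2_eq_square)
  next
    case (Suc m)
    \<comment> \<open>As a function of \<open>t\<close>,
      \<open>t * a (Suc m) - t\<^sup>2 / 2\<close> is largest at \<open>t = a (Suc m)\<close>, which
      is the new value of the running maximum whenever that maximum increases.\<close>
    have "A m * a (Suc m) - (A m)\<^sup>2 / 2 \<le> A (Suc m) * a (Suc m) - (A (Suc m))\<^sup>2 / 2"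
    proof (cases "a (Suc m) \<le> A m")
      case False
      have "0 \<le> (a (Suc m) - A m)\<^sup>2"
        by simp
      with False show ?thesis
        by (simp add: A_Suc max_def power2_eq_square algebra_simps)
    qed (simp add: A_Suc max_def)
    with Suc show ?case
      by (simp add: algebra_simps)
  qed
  \<comment> \<open>By \<open>transform\<close> the left side is at most
    \<open>4 * A m * a m - (A m)\<^sup>2\<close>, and this square is its distance to
    \<open>4 * (a m)\<^sup>2\<close>.\<close>
  have "0 \<le> (A m - 2 * a m)\<^sup>2"
    by simp
  with transform[of m] show ?thesis
    unfolding A_def[symmetric] by (simp add: power2_eq_square algebra_simps)
qed

lemma doob_partial_sum:
  assumes "m < n" "(\<Sum>i=1..n. x i) = 0"
  shows "(\<Sum>\<sigma> | \<sigma> permutes {1..n}. (MAX k\<in>{..m}. \<bar>partial_sum x \<sigma> k / real (n - k)\<bar>)\<^sup>2)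
    \<le> 4 * (\<Sum>\<sigma> | \<sigma> permutes {1..n}. (partial_sum x \<sigma> m / real (n - m))\<^sup>2)"
proof -
  define M where "M \<sigma> k = partial_sum x \<sigma> k / real (n - k)" for \<sigma> k
  define A where "A \<sigma> k = (MAX i\<in>{..k}. \<bar>M \<sigma> i\<bar>)" for \<sigma> k
  let ?E = "\<lambda>f. \<Sum>\<sigma> | \<sigma> permutes {1..n}. f \<sigma>"
  have A_nonneg: "0 \<le> A \<sigma> k" for \<sigma> k
    unfolding A_def by (subst Max_ge_iff) auto
  have past: "M (\<sigma> \<circ> Transposition.transpose (Suc k) j) i = M \<sigma> i" if "k < j" "i \<le> k" for \<sigma> i j k
    using that by (simp add: M_def partial_sum_transpose)
  have increment: "0 \<le> ?E (\<lambda>\<sigma>. A \<sigma> k * (\<bar>M \<sigma> (Suc k)\<bar> - \<bar>M \<sigma> k\<bar>))" if "k < m" for k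
  proof -
    \<comment> \<open>The sign of \<open>M \<sigma> k\<close> is determined by the past, so it can
      be part of the weight; it turns the martingale identity into the submartingale property of
      \<open>\<bar>M\<bar>\<close>.\<close>
    have "0 = ?E (\<lambda>\<sigma>. A \<sigma> k * sgn (M \<sigma> k) * (M \<sigma> (Suc k) - M \<sigma> k))"
      using martingale_increment[of k n x "\<lambda>\<sigma>. A \<sigma> k * sgn (M \<sigma> k)", folded M_def] that assms
      by (simp add: A_def past)
    also have "\<dots> \<le> ?E (\<lambda>\<sigma>. A \<sigma> k * (\<bar>M \<sigma> (Suc k)\<bar> - \<bar>M \<sigma> k\<bar>))"
      unfolding mult.assoc
      by (intro sum_mono mult_left_mono A_nonneg) (auto simp: sgn_if abs_if algebra_simps)
    finally show ?thesis .
  qed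
  have "?E (\<lambda>\<sigma>. (A \<sigma> m)\<^sup>2)
      \<le> ?E (\<lambda>\<sigma>. 4 * (M \<sigma> m)\<^sup>2 - 4 * (\<Sum>k<m. A \<sigma> k * (\<bar>M \<sigma> (Suc k)\<bar> - \<bar>M \<sigma> k\<bar>)))"
    using pathwise_doob[of "\<lambda>k. \<bar>M _ k\<bar>" m] unfolding A_def
    by (intro sum_mono) (simp add: algebra_simps)
  also have "\<dots> = 4 * ?E (\<lambda>\<sigma>. (M \<sigma> m)\<^sup>2)
      - 4 * (\<Sum>k<m. ?E (\<lambda>\<sigma>. A \<sigma> k * (\<bar>M \<sigma> (Suc k)\<bar> - \<bar>M \<sigma> k\<bar>)))"
    by (subst sum.swap) (simp add: sum_subtractf sum_distrib_left)
  also have "\<dots> \<le> 4 * ?E (\<lambda>\<sigma>. (M \<sigma> m)\<^sup>2)"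
    by (simp, rule sum_nonneg) (use increment in simp)
  finally show ?thesis
    by (simp add: A_def M_def)
qed

section \<open>Maximum over an initial segment of indices\<close>

text \<open>Since \<open>n - k \<le> n\<close>, the maximal partial sum is at most \<open>n\<close>
  times the maximum of the martingale. Doob's inequality and the second moment at \<open>m\<close>
  then give the constant.\<close>

lemma sum_permutes_max_initial:
  assumes "2 \<le> n" "m < n" "(\<Sum>i=1..n. x i) = 0"
  shows "(\<Sum>\<sigma> | \<sigma> permutes {1..n}. (MAX k\<in>{..m}. \<bar>partial_sum x \<sigma> k\<bar>)\<^sup>2)
    \<le> fact n * (4 * real n * real m / ((real n - 1) * (real n - real m)) * (\<Sum>i=1..n. (x i)\<^sup>2))"
proof -
  let ?E = "\<lambda>f. \<Sum>\<sigma> | \<sigma> permutes {1..n}. f \<sigma>"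
  have "?E (\<lambda>\<sigma>. (MAX k\<in>{..m}. \<bar>partial_sum x \<sigma> k\<bar>)\<^sup>2)
      \<le> ?E (\<lambda>\<sigma>. (real n * (MAX k\<in>{..m}. \<bar>partial_sum x \<sigma> k / real (n - k)\<bar>))\<^sup>2)"
  proof (intro sum_mono power_mono)
    fix \<sigma>
    let ?A = "MAX k\<in>{..m}. \<bar>partial_sum x \<sigma> k / real (n - k)\<bar>"
    show "0 \<le> (MAX k\<in>{..m}. \<bar>partial_sum x \<sigma> k\<bar>)"
      by (subst Max_ge_iff) auto
    show "(MAX k\<in>{..m}. \<bar>partial_sum x \<sigma> k\<bar>) \<le> real n * ?A"
    proof (intro Max.boundedI)
      fix y assume "y \<in> (\<lambda>k. \<bar>partial_sum x \<sigma> k\<bar>) ` {..m}"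
      then obtain k where k: "k \<le> m" "y = \<bar>partial_sum x \<sigma> k\<bar>"
        by auto
      have "y = real (n - k) * \<bar>partial_sum x \<sigma> k / real (n - k)\<bar>"
        using k assms(2) by (simp add: abs_divide)
      also have "\<dots> \<le> real n * \<bar>partial_sum x \<sigma> k / real (n - k)\<bar>"
        by (intro mult_right_mono) auto
      also have "\<dots> \<le> real n * ?A"
        using k by (intro mult_left_mono Max_ge) auto
      finally show "y \<le> real n * ?A" .
    qed auto
  qed
  also have "\<dots> = (real n)\<^sup>2 * ?E (\<lambda>\<sigma>. (MAX k\<in>{..m}. \<bar>partial_sum x \<sigma> k / real (n - k)\<bar>)\<^sup>2)"
    by (simp only: power_mult_distrib sum_distrib_left)
  also have "\<dots> \<le> (real n)\<^sup>2 * (4 * ?E (\<lambda>\<sigma>. (partial_sum x \<sigma> m / real (n - m))\<^sup>2))"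
    using doob_partial_sum[OF assms(2,3)] by (intro mult_left_mono) auto
  also have "\<dots> = 4 * (real n)\<^sup>2 / (real n - real m)\<^sup>2 * ?E (\<lambda>\<sigma>. (partial_sum x \<sigma> m)\<^sup>2)"
    using assms(2) by (simp add: power_divide of_nat_diff flip: sum_divide_distrib)
  also have "\<dots> = fact n * (4 * real n * real m / ((real n - 1) * (real n - real m)) * (\<Sum>i=1..n. (x i)\<^sup>2))"
    using assms sum_permutes_partial_sum_square[of n m x] by (simp add: power2_eq_square mult_ac)
  finally show ?thesis .
qed

section \<open>Reversal and combination of the two halves\<close>

lemma reflection_permutes: "(\<lambda>i. if i \<in> {1..n} then Suc n - i else i) permutes {1..n}"
proof (rule bij_imp_permutes)
  show "bij_betw (\<lambda>i. if i \<in> {1..n} then Suc n - i else i) {1..n} {1..n}"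
    by (rule bij_betw_byWitness[where f' = "\<lambda>i. Suc n - i"]) auto
qed auto

text \<open>The first \<open>n - k\<close> terms in reversed order are the last \<open>n - k\<close>
  terms of the original order, and the total is zero.\<close>

lemma partial_sum_reflection:
  assumes "\<sigma> permutes {1..n}" "k \<le> n" "(\<Sum>i=1..n. x i) = 0"
  shows "partial_sum x (\<sigma> \<circ> (\<lambda>i. if i \<in> {1..n} then Suc n - i else i)) (n - k) = - partial_sum x \<sigma> k"
proof -
  have "partial_sum x (\<sigma> \<circ> (\<lambda>i. if i \<in> {1..n} then Suc n - i else i)) (n - k)
      = (\<Sum>i=Suc k..n. x (\<sigma> i))"
    unfolding partial_sum_def
    by (rule sum.reindex_bij_witness[where i = "\<lambda>i. Suc n - i" and j = "\<lambda>i. Suc n - i"])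
      (use assms(2) in auto)
  then show ?thesis
    using partial_sum_complement[OF assms] by simp
qed

text \<open>An index \<open>k > m\<close> satisfies \<open>n - k \<le> m'\<close>, so reversal moves
  it into the initial segment up to \<open>m'\<close>. Reversal permutes the permutations, hence it
  disappears from the second sum.\<close>

lemma sum_permutes_max_split:
  assumes "m + m' = n - 1" "1 \<le> n" "(\<Sum>i=1..n. x i) = 0"
  shows "(\<Sum>\<sigma> | \<sigma> permutes {1..n}. MAX k\<in>{1..n}. \<bar>partial_sum x \<sigma> k\<bar>\<^sup>2)
    \<le> (\<Sum>\<sigma> | \<sigma> permutes {1..n}. (MAX k\<in>{..m}. \<bar>partial_sum x \<sigma> k\<bar>)\<^sup>2)
      + (\<Sum>\<sigma> | \<sigma> permutes {1..n}. (MAX k\<in>{..m'}. \<bar>partial_sum x \<sigma> k\<bar>)\<^sup>2)"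
proof -
  define \<rho> where "\<rho> = (\<lambda>i. if i \<in> {1..n} then Suc n - i else i)"
  define B where "B = (\<lambda>l \<sigma>. MAX k\<in>{..l}. \<bar>partial_sum x \<sigma> k\<bar>)"
  have le_B: "\<bar>partial_sum x \<sigma> k\<bar>\<^sup>2 \<le> (B l \<sigma>)\<^sup>2" if "k \<le> l" for k l \<sigma>
    unfolding B_def using that by (intro power_mono Max_ge) auto
  have bound: "(MAX k\<in>{1..n}. \<bar>partial_sum x \<sigma> k\<bar>\<^sup>2) \<le> (B m \<sigma>)\<^sup>2 + (B m' (\<sigma> \<circ> \<rho>))\<^sup>2"
    if "\<sigma> permutes {1..n}" for \<sigma>
  proof (intro Max.boundedI)
    fix y assume "y \<in> (\<lambda>k. \<bar>partial_sum x \<sigma> k\<bar>\<^sup>2) ` {1..n}"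
    then obtain k where k: "k \<le> n" "y = \<bar>partial_sum x \<sigma> k\<bar>\<^sup>2"
      by auto
    show "y \<le> (B m \<sigma>)\<^sup>2 + (B m' (\<sigma> \<circ> \<rho>))\<^sup>2"
    proof (cases "k \<le> m")
      case True
      then show ?thesis
        using le_B[of k m \<sigma>] k by (simp add: add_increasing2)
    next
      case False
      then have "y \<le> (B m' (\<sigma> \<circ> \<rho>))\<^sup>2"
        using le_B[of "n - k" m' "\<sigma> \<circ> \<rho>"] partial_sum_reflection[OF that k(1) assms(3)] k assms(1)
        unfolding \<rho>_def by simp
      then show ?thesis
        by (simp add: add_increasing)
    qed
  qed (use assms(2) in auto)
  have "(\<Sum>\<sigma> | \<sigma> permutes {1..n}. MAX k\<in>{1..n}. \<bar>partial_sum x \<sigma> k\<bar>\<^sup>2)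
      \<le> (\<Sum>\<sigma> | \<sigma> permutes {1..n}. (B m \<sigma>)\<^sup>2 + (B m' (\<sigma> \<circ> \<rho>))\<^sup>2)"
    using bound by (intro sum_mono) auto
  also have "\<dots> = (\<Sum>\<sigma> | \<sigma> permutes {1..n}. (B m \<sigma>)\<^sup>2) + (\<Sum>\<sigma> | \<sigma> permutes {1..n}. (B m' \<sigma>)\<^sup>2)"
    using sum_permutations_compose_right[OF reflection_permutes, of "\<lambda>\<sigma>. (B m' \<sigma>)\<^sup>2" n]
    unfolding \<rho>_def by (simp add: sum.distrib)
  finally show ?thesis
    by (simp add: B_def)
qed

text \<open>For \<open>n = 2 * l\<close> the sum is
  \<open>16 * l\<^sup>2 / ((2 * l - 1) * (l + 1))\<close>, at most 8 because
  \<open>l \<ge> 1\<close>; for \<open>n = 2 * l + 1\<close> it is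
  \<open>8 - 4 / (l + 1)\<close>.\<close>

lemma halves_constant:
  assumes "2 \<le> n" "m = n div 2" "m' = n - 1 - m"
  shows "4 * real n * real m / ((real n - 1) * (real n - real m))
    + 4 * real n * real m' / ((real n - 1) * (real n - real m')) \<le> 8"
proof (cases "even n")
  case True
  then obtain l where "n = 2 * l"
    by blast
  with assms have l: "real n = 2 * real l" "real m = real l" "real m' = real l - 1" "1 \<le> real l"
    by auto
  show ?thesis
    unfolding l(1-3) using l(4) by (simp add: divide_simps) (simp add: algebra_simps power2_eq_square)
next
  case False
  then obtain l where "n = 2 * l + 1"
    by (rule oddE)
  with assms have l: "real n = 2 * real l + 1" "real m = real l" "real m' = real l" "1 \<le> real l"
    by auto
  show ?thesis
    unfolding l(1-3) using l(4) by (simp add: divide_simps)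
qed

theorem proposition2:
  fixes n :: nat and x :: "nat \<Rightarrow> real"
  assumes "n \<ge> 1"
    and "(\<Sum>i=1..n. x i) = 0"
  shows "1 / fact n * (\<Sum>\<sigma> | \<sigma> permutes {1..n}. MAX k\<in>{1..n}. \<bar>\<Sum>i=1..k. x (\<sigma> i)\<bar>\<^sup>2)
           \<le> (8 + 1 / 5) * (\<Sum>i=1..n. (x i)\<^sup>2)"
proof (cases "n = 1")
  \<comment> \<open>This case is separate because the second moment formula has \<open>n - 1\<close>
    in its denominator; here the only term is zero.\<close>
  case True
  with assms show ?thesis
    by (simp add: permutes_sing)
next
  case False
  with assms have n: "2 \<le> n"
    by simp
  let ?Q = "\<Sum>i=1..n. (x i)\<^sup>2"
  let ?S = "\<Sum>\<sigma> | \<sigma> permutes {1..n}. MAX k\<in>{1..n}. \<bar>partial_sum x \<sigma> k\<bar>\<^sup>2"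
  \<comment> \<open>The forward half covers the indices up to \<open>m\<close>, the reversed half
    those from \<open>m + 1\<close> to \<open>n\<close>.\<close>
  define m m' where "m = n div 2" and "m' = n - 1 - m"
  let ?C = "\<lambda>m. 4 * real n * real m / ((real n - 1) * (real n - real m))"
  have Q: "0 \<le> ?Q"
    by (simp add: sum_nonneg)
  have m: "m < n" "m' < n" "m + m' = n - 1"
    using n by (auto simp: m_def m'_def)
  have "?S \<le> fact n * (?C m * ?Q) + fact n * (?C m' * ?Q)"
    using sum_permutes_max_split[OF m(3) assms]
      sum_permutes_max_initial[OF n m(1) assms(2)] sum_permutes_max_initial[OF n m(2) assms(2)]
    by linarith
  then have "1 / fact n * ?S \<le> (?C m + ?C m') * ?Q"
    by (simp add: field_simps)
  also have "\<dots> \<le> (8 + 1 / 5) * ?Q"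
    using halves_constant[OF n m_def m'_def] Q by (intro mult_right_mono) auto
  finally show ?thesis
    by (simp add: partial_sum_def)
qed

end
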